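(* Let $R$ be a finite Frobenius ring and let $C\leq{}_RR^n$ be a modular linear code generated by (the rows of) $\mathbf{G}=(\mathbf{g}_1|\dots|\mathbf{g}_n)\in R^{k\times n}$, i.e. $C=\{\mathbf{x}\mathbf{G};\mathbf{x}\in R^k\}$. Let $D=\{\mathbf{G}\mathbf{y};\mathbf{y}\in R^n\}\leq R^k_R$ be the right column space of $\mathbf{G}$. Suppose that $C$ has no all-zero coordinate and that $C_0=\{\mathbf{0}\}$. Then the following are equivalent: (i) $C$ is a homogeneous two-weight code; (ii) $\Omega=\mathbf{g}_1R^\times\cup\dots\cup\mathbf{g}_nR^\times$ is a regular partial difference set in $(D,+)$ and $\Omega\cup\{\mathbf{0}\}$ is not a submodule of $R^k_R$.
   Context: A finite ring $R$ (with $1$, unit group $R^\times$) is a Frobenius ring if there is a character $\chi\in\mathrm{Hom}_{\mathbb{Z}}(R,\mathbb{C}^\times)$ of $(R,+)$ whose kernel contains no nonzero left (or right) ideal of $R$. The (normalized) homogeneous weight is $w_{\mathrm{hom}}(x)=1-\frac{1}{|R^\times|}\sum_{u\in R^\times}\chi(ux)$ for $x\in R$ (independent of the choice of $\chi$; it takes real values $\ge 0$), extended to $R^n$ by $w_{\mathrm{hom}}(\mathbf{x})=\sum_{j=1}^n w_{\mathrm{hom}}(x_j)$. A (left) linear code $C\leq{}_RR^n$ is a submodule of the left module ${}_RR^n$. Put $C_0=\{\mathbf{c}\in C;w_{\mathrm{hom}}(\mathbf{c})=0\}$. $C$ is a homogeneous two-weight code if its codewords take exactly two distinct nonzero homogeneous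 weights. Points of the projective geometry $\mathrm{PG}(R^k_R)$ are the nonzero cyclic submodules $\mathbf{g}R$ of the free right module $R^k_R$ (column vectors). If $C$ has no all-zero coordinate and $C=\{\mathbf{x}\mathbf{G};\mathbf{x}\in R^k\}$ with $\mathbf{G}=(\mathbf{g}_1|\dots|\mathbf{g}_n)\in R^{k\times n}$, put $\alpha_C(\mathbf{g}R)=|\{j;1\le j\le n,\ \mathbf{g}_jR=\mathbf{g}R\}|$ for every point $\mathbf{g}R$. The code $C$ is modular if there exists $r\in\mathbb{Q}$ (called the index) such that for every point $\mathbf{g}R$ either $\alpha_C(\mathbf{g}R)=0$ or $\alpha_C(\mathbf{g}R)=r\,|\mathbf{g}R^\times|$. (This does not depend on the choice of $k$ and $\mathbf{G}$.) A subset $E$ of a finite abelian group $G$ (written additively) is a regular $(N,K,\lambda,\mu)$ partial difference set in $G$ if $N=|G|$, $K=|E|$, $0\notin E$, $-E=E$, and the multiset $E-E$ of differences represents each element of $E$ exactly $\lambda$ times and each element of $G\setminus(E\cup\{0\})$ exactly $\mu$ times; it is a regular partial difference set if this holds for some $N,K,\lambda,\mu$. *)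

theory Defs
  imports Complex_Main "HOL-Algebra.Group" "HOL-Algebra.Coset" "Jordan_Normal_Form.Matrix"
begin

text \<open>
  Rings are finite types of class \<open>ring_1\<close>; multiplication is not assumed commutative.  Vectors over
  such a ring are the carrier-based vectors of \<open>Jordan_Normal_Form\<close>, so that lengths are ordinary
  natural numbers.  There \<open>a \<cdot>\<^sub>v v\<close> is the left scalar multiple, \<open>v \<bullet> w\<close> is the sum of the products
  \<open>v $ i * w $ i\<close> in this order, and \<open>A *\<^sub>v v\<close> has the entries \<open>row A i \<bullet> v\<close>.
\<close>

subsection \<open>Frobenius rings and the homogeneous weight\<close>

(* The two-sided condition matters: the library's "u dvd 1" only gives a right inverse. *)
definition ring_units :: "'a::ring_1 set" where
  "ring_units = {u. \<exists>v. u * v = 1 \<and> v * u = 1}"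

definition left_ideal :: "'a::ring_1 set \<Rightarrow> bool" where
  "left_ideal I \<longleftrightarrow> 0 \<in> I \<and> (\<forall>x\<in>I. \<forall>y\<in>I. x + y \<in> I) \<and> (\<forall>a. \<forall>x\<in>I. a * x \<in> I)"

definition right_ideal :: "'a::ring_1 set \<Rightarrow> bool" where
  "right_ideal I \<longleftrightarrow> 0 \<in> I \<and> (\<forall>x\<in>I. \<forall>y\<in>I. x + y \<in> I) \<and> (\<forall>a. \<forall>x\<in>I. x * a \<in> I)"

definition additive_character :: "('a::ring_1 \<Rightarrow> complex) \<Rightarrow> bool" where
  "additive_character \<chi> \<longleftrightarrow> (\<forall>x. \<chi> x \<noteq> 0) \<and> (\<forall>x y. \<chi> (x + y) = \<chi> x * \<chi> y)"

(* For finite rings the left and the right condition are equivalent; the disjunction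
   asks for either one of them. *)
definition generating_character :: "('a::{ring_1,finite} \<Rightarrow> complex) \<Rightarrow> bool" where
  "generating_character \<chi> \<longleftrightarrow> additive_character \<chi> \<and>
     ((\<forall>I. left_ideal I \<and> I \<subseteq> {x. \<chi> x = 1} \<longrightarrow> I = {0}) \<or>
      (\<forall>I. right_ideal I \<and> I \<subseteq> {x. \<chi> x = 1} \<longrightarrow> I = {0}))"

definition frobenius_ring :: "'a::{ring_1,finite} itself \<Rightarrow> bool" where
  "frobenius_ring _ \<longleftrightarrow> (\<exists>\<chi> :: 'a \<Rightarrow> complex. generating_character \<chi>)"

(* Complex valued as written; for a generating character the values are nonnegative reals
   that do not depend on the character. *)
definition hom_weight :: "('a::{ring_1,finite} \<Rightarrow> complex) \<Rightarrow> 'a \<Rightarrow> complex" where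
  "hom_weight \<chi> x =
     1 - (1 / of_nat (card (ring_units :: 'a set))) * (\<Sum>u\<in>ring_units. \<chi> (u * x))"

definition hom_weight_vec :: "('a::{ring_1,finite} \<Rightarrow> complex) \<Rightarrow> 'a vec \<Rightarrow> complex" where
  "hom_weight_vec \<chi> v = (\<Sum>j<dim_vec v. hom_weight \<chi> (v $ j))"

subsection \<open>Submodules, linear codes and column spaces\<close>

definition smult_vec_right :: "'a::times vec \<Rightarrow> 'a \<Rightarrow> 'a vec" where
  "smult_vec_right v a = vec (dim_vec v) (\<lambda>i. v $ i * a)"

definition left_submodule :: "nat \<Rightarrow> 'a::ring_1 vec set \<Rightarrow> bool" where
  "left_submodule n S \<longleftrightarrow> S \<subseteq> carrier_vec n \<and> 0\<^sub>v n \<in> S \<and>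
     (\<forall>x\<in>S. \<forall>y\<in>S. x + y \<in> S) \<and> (\<forall>a. \<forall>x\<in>S. a \<cdot>\<^sub>v x \<in> S)"

definition right_submodule :: "nat \<Rightarrow> 'a::ring_1 vec set \<Rightarrow> bool" where
  "right_submodule k S \<longleftrightarrow> S \<subseteq> carrier_vec k \<and> 0\<^sub>v k \<in> S \<and>
     (\<forall>x\<in>S. \<forall>y\<in>S. x + y \<in> S) \<and> (\<forall>a. \<forall>x\<in>S. smult_vec_right x a \<in> S)"

(* the product x G of a row vector x with G *)
definition row_mult_mat :: "'a::ring_1 vec \<Rightarrow> 'a mat \<Rightarrow> 'a vec" where
  "row_mult_mat x G = vec (dim_col G) (\<lambda>j. x \<bullet> col G j)"

definition row_code :: "'a::ring_1 mat \<Rightarrow> 'a vec set" where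
  "row_code G = {row_mult_mat x G | x. x \<in> carrier_vec (dim_row G)}"

definition right_col_space :: "'a::ring_1 mat \<Rightarrow> 'a vec set" where
  "right_col_space G = {G *\<^sub>v y | y. y \<in> carrier_vec (dim_col G)}"

definition no_zero_coordinate :: "nat \<Rightarrow> 'a::ring_1 vec set \<Rightarrow> bool" where
  "no_zero_coordinate n C \<longleftrightarrow> (\<forall>j<n. \<exists>c\<in>C. c $ j \<noteq> 0)"

definition zero_weight_words :: "('a::{ring_1,finite} \<Rightarrow> complex) \<Rightarrow> 'a vec set \<Rightarrow> 'a vec set" where
  "zero_weight_words \<chi> C = {c \<in> C. hom_weight_vec \<chi> c = 0}"

definition hom_two_weight_code :: "('a::{ring_1,finite} \<Rightarrow> complex) \<Rightarrow> 'a vec set \<Rightarrow> bool" where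
  "hom_two_weight_code \<chi> C \<longleftrightarrow> card (hom_weight_vec \<chi> ` C - {0}) = 2"

subsection \<open>Modular codes\<close>

definition cyclic_right :: "'a::ring_1 vec \<Rightarrow> 'a vec set" where
  "cyclic_right g = range (smult_vec_right g)"

definition unit_orbit :: "'a::ring_1 vec \<Rightarrow> 'a vec set" where
  "unit_orbit g = smult_vec_right g ` ring_units"

definition point_mult :: "'a::ring_1 mat \<Rightarrow> 'a vec set \<Rightarrow> nat" where
  "point_mult G P = card {j. j < dim_col G \<and> cyclic_right (col G j) = P}"

(* A point is given by any of its generators g; over a finite ring the orbit of g under the units
   only depends on the point.  Whether the condition on the index r holds does not depend on the
   chosen generating matrix either, so it is required for some G. *)
definition modular_code :: "nat \<Rightarrow> 'a::{ring_1,finite} vec set \<Rightarrow> bool" where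
  "modular_code n C \<longleftrightarrow>
     (\<exists>k. \<exists>G\<in>carrier_mat k n. C = row_code G \<and>
        (\<exists>r::rat. \<forall>g\<in>carrier_vec k. g \<noteq> 0\<^sub>v k \<longrightarrow>
            point_mult G (cyclic_right g) = 0 \<or>
            of_nat (point_mult G (cyclic_right g)) = r * of_nat (card (unit_orbit g))))"

subsection \<open>Partial difference sets\<close>

(* The library's groups are written multiplicatively: inverses and quotients stand for
   negatives and differences. *)
definition regular_pds_with ::
    "('g, 'm) monoid_scheme \<Rightarrow> 'g set \<Rightarrow> nat \<Rightarrow> nat \<Rightarrow> nat \<Rightarrow> nat \<Rightarrow> bool" where
  "regular_pds_with A E N K l m \<longleftrightarrow>
     comm_group A \<and> finite (carrier A) \<and> E \<subseteq> carrier A \<and>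
     N = order A \<and> K = card E \<and> \<one>\<^bsub>A\<^esub> \<notin> E \<and> m_inv A ` E = E \<and>
     (\<forall>d\<in>E. card {(x, y). x \<in> E \<and> y \<in> E \<and> x \<otimes>\<^bsub>A\<^esub> inv\<^bsub>A\<^esub> y = d} = l) \<and>
     (\<forall>d\<in>carrier A - (E \<union> {\<one>\<^bsub>A\<^esub>}).
        card {(x, y). x \<in> E \<and> y \<in> E \<and> x \<otimes>\<^bsub>A\<^esub> inv\<^bsub>A\<^esub> y = d} = m)"

definition regular_pds :: "('g, 'm) monoid_scheme \<Rightarrow> 'g set \<Rightarrow> bool" where
  "regular_pds A E \<longleftrightarrow> (\<exists>N K l m. regular_pds_with A E N K l m)"

(* monoid_vec is the additive monoid of all vectors of length k *)
definition vec_subgroup :: "nat \<Rightarrow> 'a::ring_1 vec set \<Rightarrow> 'a vec monoid" where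
  "vec_subgroup k D = (monoid_vec TYPE('a) k)\<lparr>carrier := D\<rparr>"

end

theory Submission
  imports Defs
begin

text \<open>
  In a modular code every \<open>w \<in> \<Omega>\<close> arises equally often as \<open>g\<^sub>j u\<close> with \<open>u\<close> a unit; this uses that
  the generators of a cyclic module \<open>g R\<close> form a single orbit under the units.  Hence the weight of
  the codeword \<open>x G\<close> is \<open>n - r f(x)\<close> with \<open>f(x) = (\<Sum>w\<in>\<Omega>. \<chi> (x \<bullet> w))\<close>, which is the Fourier transform of
  the indicator function of \<open>\<Omega>\<close>, because the maps \<open>d \<mapsto> \<chi> (x \<bullet> d)\<close> are the characters of \<open>D\<close>.  By
  Fourier inversion \<open>\<Omega>\<close> is a regular partial difference set iff \<open>f\<close> satisfies a monic quadratic
  equation off the trivial character, i.e. has at most two values there, and there is at most one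
  value iff \<open>\<Omega> = D - {0}\<close>.
\<close>

section \<open>Generating characters\<close>

lemma additive_character_zero: "additive_character \<chi> \<Longrightarrow> \<chi> 0 = 1"
  unfolding additive_character_def by (metis add_0 mult_cancel_right1)

lemma additive_character_add: "additive_character \<chi> \<Longrightarrow> \<chi> (x + y) = \<chi> x * \<chi> y"
  unfolding additive_character_def by blast

lemma additive_character_diff_eq_1_iff:
  assumes "additive_character \<chi>"
  shows "\<chi> (x - y) = 1 \<longleftrightarrow> \<chi> x = \<chi> y"
proof -
  have "\<chi> x = \<chi> (x - y) * \<chi> y"
    using additive_character_add[OF assms, of "x - y" y] by simp
  moreover have "\<chi> y \<noteq> 0"
    using assms unfolding additive_character_def by blast
  ultimately show ?thesis by auto
qed

text \<open>Reindexing by the permutation \<open>t\<close> shows that the sum is \<open>c\<close>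
  times itself. With \<open>t\<close> the translation by an element at which a character differs
  from 1, this is character orthogonality.\<close>

lemma sum_eq_0_of_translation:
  fixes F :: "'b \<Rightarrow> complex"
  assumes t: "bij_betw t S S" and F: "\<And>x. x \<in> S \<Longrightarrow> F (t x) = c * F x" and "c \<noteq> 1"
  shows "sum F S = 0"
proof -
  have "sum F S = (\<Sum>x\<in>S. F (t x))"
    by (rule sum.reindex_bij_betw[OF t, symmetric])
  also have "\<dots> = c * sum F S"
    using F by (simp add: sum_distrib_left)
  finally show ?thesis using \<open>c \<noteq> 1\<close> by simp
qed

lemma sum_additive_UNIV:
  fixes F :: "'a::{ring_1,finite} \<Rightarrow> complex"
  assumes F: "\<And>x y. F (x + y) = F x * F y"
  shows "sum F UNIV = (if \<forall>x. F x = 1 then of_nat (card (UNIV :: 'a set)) else 0)"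
proof (cases "\<forall>x. F x = 1")
  case False
  then obtain y where y: "F y \<noteq> 1" by blast
  have "bij (\<lambda>x. y + x)" by (rule bij_plus)
  then have "sum F UNIV = 0"
    by (rule sum_eq_0_of_translation) (use F y in auto)
  then show ?thesis using False by auto
qed simp

text \<open>Summing \<open>\<chi> (a * x)\<close> over all pairs in both orders shows that the left and the right
  annihilator of the form \<open>\<chi> (a * x)\<close> have the same size.\<close>
lemma generating_character_nondegenerate:
  fixes \<chi> :: "'a::{ring_1,finite} \<Rightarrow> complex"
  assumes "generating_character \<chi>"
  shows "(\<forall>a. \<chi> (a * x) = 1) \<Longrightarrow> x = 0" and "(\<forall>a. \<chi> (x * a) = 1) \<Longrightarrow> x = 0"
proof -
  have ac: "additive_character \<chi>"
    using assms unfolding generating_character_def by blast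
  note [simp] = additive_character_zero[OF ac] additive_character_add[OF ac]
  define L where "L = {x. \<forall>a. \<chi> (a * x) = 1}"
  define M where "M = {x. \<forall>a. \<chi> (x * a) = 1}"
  have count: "(\<Sum>x\<in>UNIV. if P x then of_nat (card (UNIV :: 'a set)) else (0::complex))
      = of_nat (card {x. P x}) * of_nat (card (UNIV :: 'a set))" for P :: "'a \<Rightarrow> bool"
    by (simp add: sum.If_cases)
  have "(\<Sum>x\<in>UNIV. \<Sum>a\<in>UNIV. \<chi> (a * x)) = of_nat (card L) * of_nat (card (UNIV :: 'a set))"
    unfolding L_def count[symmetric]
    by (intro sum.cong refl sum_additive_UNIV) (simp add: distrib_right)
  moreover have "(\<Sum>x\<in>UNIV. \<Sum>a\<in>UNIV. \<chi> (a * x)) = of_nat (card M) * of_nat (card (UNIV :: 'a set))"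
    unfolding M_def count[symmetric]
    by (subst sum.swap, intro sum.cong refl sum_additive_UNIV) (simp add: distrib_left)
  ultimately have "of_nat (card L) * of_nat (card (UNIV :: 'a set)) = (of_nat (card M) * of_nat (card (UNIV :: 'a set)) :: complex)"
    by simp
  then have card: "card L = card M"
    by (simp flip: of_nat_mult)
  have zero: "0 \<in> L" "0 \<in> M" by (simp_all add: L_def M_def)
  have ker: "L \<subseteq> {x. \<chi> x = 1}" "M \<subseteq> {x. \<chi> x = 1}"
    unfolding L_def M_def by (auto, (metis mult_1 mult_1_right)+)
  have "left_ideal L"
    unfolding left_ideal_def L_def by (auto simp: distrib_left) (metis mult.assoc)
  moreover have "right_ideal M"
    unfolding right_ideal_def M_def by (auto simp: distrib_right mult.assoc)
  \<comment> \<open>The definition of a generating character excludes nonzero ideals in the kernel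
    on one side only; the equality of the two cardinalities carries triviality over to the other
    side.\<close>
  ultimately have "L = {0} \<or> M = {0}"
    using assms ker unfolding generating_character_def by blast
  then have "card L = 1 \<and> card M = 1" using card by auto
  then have "L = {0}" "M = {0}"
    using zero by (metis card_1_singletonE singletonD)+
  then show "(\<forall>a. \<chi> (a * x) = 1) \<Longrightarrow> x = 0" "(\<forall>a. \<chi> (x * a) = 1) \<Longrightarrow> x = 0"
    by (auto simp: L_def M_def)
qed

text \<open>Double count: if no \<open>s\<close> worked, every character
  \<open>\<chi> (r * x - x * s)\<close> of \<open>x\<close> would be nontrivial and sum to 0.
  Summing over \<open>s\<close> first, however, leaves only the term \<open>x = 0\<close> by
  nondegeneracy, which contributes the order of the ring.\<close>

lemma generating_character_swap:
  fixes \<chi> :: "'a::{ring_1,finite} \<Rightarrow> complex"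
  assumes gen: "generating_character \<chi>"
  shows "\<exists>s. \<forall>x. \<chi> (r * x) = \<chi> (x * s)"
proof (rule ccontr)
  assume neg: "\<not> ?thesis"
  have ac: "additive_character \<chi>"
    using gen unfolding generating_character_def by blast
  have "(\<Sum>x\<in>UNIV. \<chi> (r * x - x * s)) = 0" for s
  proof -
    have "\<chi> (r * (x + y) - (x + y) * s) = \<chi> (r * x - x * s) * \<chi> (r * y - y * s)" for x y
    proof -
      have "r * (x + y) - (x + y) * s = (r * x - x * s) + (r * y - y * s)"
        by (simp add: algebra_simps)
      then show ?thesis by (simp only: additive_character_add[OF ac])
    qed
    moreover have "\<not> (\<forall>x. \<chi> (r * x - x * s) = 1)"
      using neg by (simp add: additive_character_diff_eq_1_iff[OF ac])
    ultimately show ?thesis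
      using sum_additive_UNIV[of "\<lambda>x. \<chi> (r * x - x * s)"] by simp
  qed
  then have "0 = (\<Sum>s\<in>(UNIV :: 'a set). \<Sum>x\<in>UNIV. \<chi> (r * x - x * s))" by simp
  also have "\<dots> = (\<Sum>x\<in>UNIV. \<Sum>s\<in>UNIV. \<chi> (r * x - x * s))"
    by (rule sum.swap)
  also have "\<dots> = (\<Sum>x\<in>UNIV. \<chi> (r * x) * (\<Sum>s\<in>UNIV. \<chi> (x * - s)))"
  proof (rule sum.cong)
    fix x
    have "\<chi> (r * x - x * s) = \<chi> (r * x) * \<chi> (x * - s)" for s
      using additive_character_add[OF ac, of "r * x" "x * - s"] by simp
    then show "(\<Sum>s\<in>UNIV. \<chi> (r * x - x * s)) = \<chi> (r * x) * (\<Sum>s\<in>UNIV. \<chi> (x * - s))"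
      by (simp add: sum_distrib_left)
  qed simp
  also have "\<dots> = (\<Sum>x\<in>(UNIV :: 'a set). if x = 0 then of_nat (card (UNIV :: 'a set)) else 0)"
  proof (rule sum.cong)
    fix x
    have "(\<Sum>s\<in>UNIV. \<chi> (x * - s)) = (\<Sum>s\<in>UNIV. \<chi> (x * s))"
      by (rule sum.reindex_bij_betw) (rule bij_uminus)
    also have "\<dots> = (if \<forall>s. \<chi> (x * s) = 1 then of_nat (card (UNIV :: 'a set)) else 0)"
      by (rule sum_additive_UNIV) (simp add: distrib_left additive_character_add[OF ac])
    also have "\<dots> = (if x = 0 then of_nat (card (UNIV :: 'a set)) else 0)"
      using generating_character_nondegenerate(2)[OF gen] additive_character_zero[OF ac] by auto
    finally show "\<chi> (r * x) * (\<Sum>s\<in>UNIV. \<chi> (x * - s)) = (if x = 0 then of_nat (card (UNIV :: 'a set)) else 0)"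
      by (simp add: additive_character_zero[OF ac])
  qed simp
  finally show False by simp
qed

text \<open>The map \<open>\<nu>\<close> below is the Nakayama automorphism of the Frobenius ring.\<close>
lemma sum_ring_units_swap:
  fixes \<chi> :: "'a::{ring_1,finite} \<Rightarrow> complex"
  assumes gen: "generating_character \<chi>"
  shows "(\<Sum>u\<in>ring_units. \<chi> (u * x)) = (\<Sum>u\<in>ring_units. \<chi> (x * u))"
proof -
  have ac: "additive_character \<chi>"
    using gen unfolding generating_character_def by blast
  note diff = additive_character_diff_eq_1_iff[OF ac]
  have eqR: "a = b" if "\<And>x. \<chi> (x * a) = \<chi> (x * b)" for a b
    using generating_character_nondegenerate(1)[OF gen, of "a - b"] that
    by (simp add: right_diff_distrib diff)
  have eqL: "a = b" if "\<And>x. \<chi> (a * x) = \<chi> (b * x)" for a b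
    using generating_character_nondegenerate(2)[OF gen, of "a - b"] that
    by (simp add: left_diff_distrib diff)
  obtain \<nu> where \<nu>: "\<And>r x. \<chi> (r * x) = \<chi> (x * \<nu> r)"
    using generating_character_swap[OF gen] by metis
  have mult: "\<nu> (r * s) = \<nu> r * \<nu> s" for r s
  proof (rule eqR)
    fix x
    have "\<chi> (x * \<nu> (r * s)) = \<chi> (r * (s * x))"
      by (simp only: \<nu>[symmetric] mult.assoc)
    also have "\<dots> = \<chi> (s * (x * \<nu> r))"
      by (simp only: \<nu>[of r "s * x"] mult.assoc)
    also have "\<dots> = \<chi> (x * (\<nu> r * \<nu> s))"
      by (simp only: \<nu>[of s "x * \<nu> r"] mult.assoc)
    finally show "\<chi> (x * \<nu> (r * s)) = \<chi> (x * (\<nu> r * \<nu> s))" .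
  qed
  have one: "\<nu> 1 = 1"
    by (rule eqR) (simp flip: \<nu>)
  have inj: "inj \<nu>"
  proof (intro injI eqL)
    fix r s x assume "\<nu> r = \<nu> s"
    then show "\<chi> (r * x) = \<chi> (s * x)"
      using \<nu>[of r x] \<nu>[of s x] by simp
  qed
  \<comment> \<open>As an injective monoid homomorphism, \<open>\<nu>\<close> maps units to units
    and so, by finiteness, permutes them. Reindexing the right-hand sum by \<open>\<nu>\<close> and
    moving the factor back to the left gives the claim.\<close>
  have "\<nu> ` ring_units \<subseteq> ring_units"
  proof clarify
    fix u :: 'a assume "u \<in> ring_units"
    then obtain v where "u * v = 1" "v * u = 1"
      unfolding ring_units_def by blast
    then have "\<nu> u * \<nu> v = 1" "\<nu> v * \<nu> u = 1"
      using one mult by metis+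
    then show "\<nu> u \<in> ring_units"
      unfolding ring_units_def by blast
  qed
  then have "\<nu> ` ring_units = ring_units"
    using inj by (intro endo_inj_surj) (auto intro: inj_on_subset)
  then have "bij_betw \<nu> ring_units ring_units"
    using inj by (auto simp: bij_betw_def intro: inj_on_subset)
  from sum.reindex_bij_betw[OF this, of "\<lambda>u. \<chi> (x * u)"] show ?thesis
    by (simp flip: \<nu>)
qed

section \<open>Cyclic submodules and unit orbits\<close>

lemma ring_units_one: "1 \<in> ring_units"
  unfolding ring_units_def by auto

lemma ring_units_mult: "u \<in> ring_units \<Longrightarrow> v \<in> ring_units \<Longrightarrow> u * v \<in> ring_units"
  unfolding ring_units_def
proof clarsimp
  fix w z assume "u * w = 1" "w * u = 1" "v * z = 1" "z * v = 1"
  then have "u * v * (z * w) = 1 \<and> z * w * (u * v) = 1"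
    by (metis mult.assoc mult_1_right)
  then show "\<exists>va. u * v * va = 1 \<and> va * (u * v) = 1" by blast
qed

lemma ring_units_inverse:
  assumes "u \<in> ring_units"
  obtains v where "v \<in> ring_units" "u * v = 1" "v * u = 1"
  using assms unfolding ring_units_def by blast

lemma ring_units_uminus:
  assumes "u \<in> ring_units"
  shows "- u \<in> ring_units"
proof -
  obtain v where "u * v = 1" "v * u = 1"
    using assms by (rule ring_units_inverse)
  then have "- u * - v = 1 \<and> - v * - u = 1" by simp
  then show ?thesis unfolding ring_units_def by blast
qed

text \<open>Surjectivity provides a right inverse \<open>y\<close>. On a finite ring it also makes
  left multiplication by \<open>x\<close> injective, so \<open>x * (y * x) = x * 1\<close> yields
  \<open>y * x = 1\<close>.\<close>

lemma ring_units_eq_right_units: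
  fixes x :: "'a::{ring_1,finite}"
  assumes "range ((*) x) = UNIV"
  shows "x \<in> ring_units"
proof -
  obtain y where y: "x * y = 1"
    using assms by (metis rangeE UNIV_I)
  have "inj ((*) x)"
    using assms by (intro finite_UNIV_surj_inj) auto
  moreover have "x * (y * x) = x * 1"
    using y by (simp flip: mult.assoc)
  ultimately have "y * x = 1"
    by (rule injD)
  with y show ?thesis
    unfolding ring_units_def by blast
qed

section \<open>Right scalar multiples and their cyclic submodules\<close>

lemma smult_vec_right_carrier [simp]:
  "smult_vec_right v a \<in> carrier_vec k \<longleftrightarrow> v \<in> carrier_vec k"
  unfolding smult_vec_right_def carrier_vec_def by simp

lemma smult_vec_right_index [simp]:
  "i < dim_vec v \<Longrightarrow> smult_vec_right v a $ i = v $ i * a"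
  "dim_vec (smult_vec_right v a) = dim_vec v"
  unfolding smult_vec_right_def by simp_all

lemma smult_vec_right_one [simp]: "smult_vec_right v (1::'a::ring_1) = v"
  by (rule eq_vecI) auto

lemma smult_vec_right_assoc [simp]:
  "smult_vec_right (smult_vec_right v a) b = smult_vec_right v (a * b :: 'a::ring_1)"
  by (rule eq_vecI) (auto simp: mult.assoc)

lemma scalar_prod_smult_vec_right:
  fixes x :: "'a::ring_1 vec"
  shows "dim_vec x = dim_vec v \<Longrightarrow> x \<bullet> smult_vec_right v a = (x \<bullet> v) * a"
  by (simp add: scalar_prod_def sum_distrib_right mult.assoc)

lemma cyclic_right_eqI:
  fixes g :: "'a::ring_1 vec"
  assumes "h = smult_vec_right g a" "g = smult_vec_right h b"
  shows "cyclic_right g = cyclic_right h"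
proof -
  have "range (smult_vec_right g) \<subseteq> range (smult_vec_right h)"
    by (subst assms(2)) auto
  moreover have "range (smult_vec_right h) \<subseteq> range (smult_vec_right g)"
    by (subst assms(1)) auto
  ultimately show ?thesis unfolding cyclic_right_def by blast
qed

lemma cyclic_right_eqD:
  fixes g :: "'a::ring_1 vec"
  assumes "cyclic_right g = cyclic_right h"
  shows "\<exists>a. h = smult_vec_right g a"
proof -
  have "h \<in> cyclic_right h"
    unfolding cyclic_right_def by (metis rangeI smult_vec_right_one)
  then show ?thesis
    using assms unfolding cyclic_right_def by blast
qed

lemma right_ideal_range: "right_ideal (range ((*) (x::'a::ring_1)))"
proof -
  have "0 \<in> range ((*) x)"
    by (rule range_eqI[where x = 0]) simp
  moreover have "x * b + x * c \<in> range ((*) x)" for b c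
    by (rule range_eqI[where x = "b + c"]) (simp add: distrib_left)
  moreover have "x * b * c \<in> range ((*) x)" for b c
    by (rule range_eqI[where x = "b * c"]) (simp add: mult.assoc)
  ultimately show ?thesis
    unfolding right_ideal_def by blast
qed

text \<open>The number of solutions \<open>x\<close> of \<open>g x = h\<close> with \<open>x R = I\<close> turns out to be the same for all
  generators \<open>h\<close> of \<open>g R\<close>: the number of solutions in a right ideal is, by translation, and the
  solutions in a right ideal are classified by the right ideal they generate.  For \<open>I = R\<close>
  and \<open>h = g\<close> the number is positive.\<close>
lemma card_generators_of_right_ideal:
  fixes g h :: "'a::{ring_1,finite} vec"
  assumes gh: "cyclic_right g = cyclic_right h" and "right_ideal I"
  shows "card {x. smult_vec_right g x = h \<and> range ((*) x) = I} =
    card {x. smult_vec_right g x = g \<and> range ((*) x) = I}"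
  using \<open>right_ideal I\<close>
proof (induction "card I" arbitrary: I rule: less_induct)
  case less
  \<comment> \<open>The solutions in \<open>I\<close> are split by the right ideal they generate:
    \<open>T h\<close> is the disjoint union of the sets \<open>S h J\<close> over
    \<open>J = I\<close> and over the proper right subideals of \<open>I\<close>, to which the
    induction hypothesis applies.\<close>
  define T where "T h = {x \<in> I. smult_vec_right g x = h}" for h
  define S where "S h J = {x. smult_vec_right g x = h \<and> range ((*) x) = J}" for h J
  define \<J> where "\<J> = {J. right_ideal J \<and> J \<subset> I}"
  have range_sub: "range ((*) x) \<subseteq> I \<longleftrightarrow> x \<in> I" for x
  proof
    assume "range ((*) x) \<subseteq> I"
    moreover have "x = x * 1" by simp
    ultimately show "x \<in> I" by blast
  qed (use less.prems in \<open>auto simp: right_ideal_def\<close>)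
  have fin: "finite \<J>" "I \<notin> \<J>" by (auto simp: \<J>_def)
  have "T h' = (\<Union>J\<in>insert I \<J>. S h' J)" for h'
  proof (intro equalityI subsetI)
    fix x assume x: "x \<in> T h'"
    then have "range ((*) x) \<subseteq> I"
      using range_sub by (simp add: T_def)
    then have "range ((*) x) \<in> insert I \<J>"
      using right_ideal_range by (auto simp: \<J>_def)
    then show "x \<in> (\<Union>J\<in>insert I \<J>. S h' J)"
      using x by (auto simp: T_def S_def)
  next
    fix x assume "x \<in> (\<Union>J\<in>insert I \<J>. S h' J)"
    then have "range ((*) x) \<subseteq> I" "smult_vec_right g x = h'"
      by (auto simp: S_def \<J>_def)
    then show "x \<in> T h'"
      using range_sub by (simp add: T_def)
  qed
  then have "card (T h') = (\<Sum>J\<in>insert I \<J>. card (S h' J))" for h'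
    using fin by (simp only:) (rule card_UN_disjoint, auto simp: S_def)
  then have T: "card (T h') = card (S h' I) + (\<Sum>J\<in>\<J>. card (S h' J))" for h'
    using fin by simp
  obtain a b where a: "h = smult_vec_right g a" and b: "g = smult_vec_right h b"
    using cyclic_right_eqD[OF gh] cyclic_right_eqD[OF gh[symmetric]] by blast
  have "card (T h) = card (T g)"
  proof (cases "T h = {} \<and> T g = {}")
    case False
    \<comment> \<open>Since \<open>h = g a\<close> and \<open>g = h b\<close>, right multiplication
      by \<open>b\<close> or \<open>a\<close> turns a solution for one vector into a solution for
      the other, so both solution sets are nonempty once one of them is.\<close>
    have "x * b \<in> T g" if "x \<in> T h" for x
      using that less.prems b unfolding T_def right_ideal_def
      by (auto simp flip: smult_vec_right_assoc)
    moreover have "x * a \<in> T h" if "x \<in> T g" for x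
      using that less.prems a unfolding T_def right_ideal_def
      by (auto simp flip: smult_vec_right_assoc)
    ultimately obtain y z where y: "y \<in> T h" and z: "z \<in> T g"
      using False by blast
    have un: "- x \<in> I" if "x \<in> I" for x
      using that less.prems unfolding right_ideal_def by (metis mult_minus1_right)
    have cl: "p - q + r \<in> I" if "p \<in> I" "q \<in> I" "r \<in> I" for p q r
      using that un less.prems unfolding right_ideal_def diff_conv_add_uminus by blast
    have tr: "smult_vec_right g (x - p + q) = w'"
      if "smult_vec_right g x = w" "smult_vec_right g p = w" "smult_vec_right g q = w'"
      for x p q w w'
    proof (rule eq_vecI)
      have "dim_vec w' = dim_vec g" using that by auto
      then show "dim_vec (smult_vec_right g (x - p + q)) = dim_vec w'" by simp
      fix i assume "i < dim_vec w'"
      then have "i < dim_vec g" using that by auto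
      then show "smult_vec_right g (x - p + q) $ i = w' $ i"
        using that by (auto simp: algebra_simps dest!: arg_cong[where f = "\<lambda>v. v $ i"])
    qed
    \<comment> \<open>Both sets are cosets of the annihilator of \<open>g\<close> in
      \<open>I\<close>, so a shift by \<open>z - y\<close> matches them.\<close>
    have "bij_betw (\<lambda>x. x - y + z) (T h) (T g)"
      by (rule bij_betw_byWitness[where f' = "\<lambda>x. x - z + y"])
        (use y z cl tr in \<open>auto simp: T_def\<close>)
    then show ?thesis by (rule bij_betw_same_card)
  qed simp
  moreover have "(\<Sum>J\<in>\<J>. card (S h J)) = (\<Sum>J\<in>\<J>. card (S g J))"
  proof (rule sum.cong)
    fix J assume "J \<in> \<J>"
    then have "card J < card I" "right_ideal J"
      by (auto simp: \<J>_def intro: psubset_card_mono)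
    then show "card (S h J) = card (S g J)"
      unfolding S_def by (rule less.hyps)
  qed simp
  ultimately have "card (S h I) = card (S g I)"
    using T[of h] T[of g] by simp
  then show ?case by (simp add: S_def)
qed

text \<open>For the forward direction take the right ideal \<open>UNIV\<close> in the count above:
  for \<open>h = g\<close> the element 1 is a solution, so \<open>g x = h\<close> also has a
  solution with \<open>x R = R\<close>, and such an \<open>x\<close> is a unit.\<close>

lemma cyclic_right_eq_iff_unit_orbit:
  fixes g h :: "'a::{ring_1,finite} vec"
  shows "cyclic_right g = cyclic_right h \<longleftrightarrow> h \<in> unit_orbit g"
proof
  assume "cyclic_right g = cyclic_right h"
  then have "card {x. smult_vec_right g x = h \<and> range ((*) x) = UNIV} =
      card {x. smult_vec_right g x = g \<and> range ((*) x) = UNIV}"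
    by (rule card_generators_of_right_ideal) (simp add: right_ideal_def)
  moreover have "1 \<in> {x. smult_vec_right g x = g \<and> range ((*) x) = UNIV}"
    by (auto simp: image_iff)
  ultimately have "{x. smult_vec_right g x = h \<and> range ((*) x) = UNIV} \<noteq> {}"
    by (metis card.empty card_0_eq empty_iff finite)
  then show "h \<in> unit_orbit g"
    unfolding unit_orbit_def using ring_units_eq_right_units by blast
next
  assume "h \<in> unit_orbit g"
  then obtain u where u: "u \<in> ring_units" "h = smult_vec_right g u"
    unfolding unit_orbit_def by blast
  then obtain v where "u * v = 1"
    by (meson ring_units_inverse)
  then have "g = smult_vec_right h v"
    using u by simp
  with u show "cyclic_right g = cyclic_right h"
    by (intro cyclic_right_eqI)
qed

section \<open>Stabilizers and orbit counting under the units\<close>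

definition unit_stabilizer :: "'a::ring_1 vec \<Rightarrow> 'a set" where
  "unit_stabilizer g = {u \<in> ring_units. smult_vec_right g u = g}"

text \<open>If \<open>h = g v\<close> with a unit \<open>v\<close>, the fibre over \<open>h\<close>
  is the coset of the stabilizer of \<open>g\<close> obtained by right multiplication with
  \<open>v\<close>.\<close>

lemma card_unit_fibre:
  fixes g h :: "'a::{ring_1,finite} vec"
  assumes "h \<in> unit_orbit g"
  shows "card {u \<in> ring_units. smult_vec_right g u = h} = card (unit_stabilizer g)"
proof -
  obtain v where v: "v \<in> ring_units" "h = smult_vec_right g v"
    using assms unfolding unit_orbit_def by blast
  obtain w where w: "w \<in> ring_units" "v * w = 1" "w * v = 1"
    using v(1) by (rule ring_units_inverse)
  have cancel: "x * v * w = x" "x * w * v = x" for x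
    using w by (simp_all add: mult.assoc)
  have "bij_betw (\<lambda>u. u * w) {u \<in> ring_units. smult_vec_right g u = h} (unit_stabilizer g)"
  proof (rule bij_betw_byWitness[where f' = "\<lambda>u. u * v"])
    have "smult_vec_right g (u * w) = g" if "smult_vec_right g u = h" for u
    proof -
      have "smult_vec_right g (u * w) = smult_vec_right h w"
        using that by (simp flip: smult_vec_right_assoc)
      then show ?thesis using v w by simp
    qed
    then show "(\<lambda>u. u * w) ` {u \<in> ring_units. smult_vec_right g u = h} \<subseteq> unit_stabilizer g"
      using w ring_units_mult by (auto simp: unit_stabilizer_def)
    have "smult_vec_right g (u * v) = h" if "smult_vec_right g u = g" for u
      using that v by (simp flip: smult_vec_right_assoc)
    then show "(\<lambda>u. u * v) ` unit_stabilizer g \<subseteq> {u \<in> ring_units. smult_vec_right g u = h}"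
      using v(1) ring_units_mult by (auto simp: unit_stabilizer_def)
  qed (simp_all add: cancel)
  then show ?thesis by (rule bij_betw_same_card)
qed

text \<open>Orbit-stabilizer: the units are partitioned into fibres over the orbit, all of the size
  of the stabilizer.\<close>

lemma card_unit_orbit:
  fixes g :: "'a::{ring_1,finite} vec"
  shows "card (unit_orbit g) * card (unit_stabilizer g) = card (ring_units :: 'a set)"
proof -
  have fin: "finite (unit_orbit g)" "finite (ring_units :: 'a set)"
    by (simp_all add: unit_orbit_def)
  have "(\<Sum>h\<in>unit_orbit g. card {u \<in> ring_units. smult_vec_right g u = h}) =
      card (ring_units :: 'a set)"
    using sum.group[OF fin(2,1), of "smult_vec_right g" "\<lambda>_. 1 :: nat"]
    by (simp add: unit_orbit_def)
  then show ?thesis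
    by (simp add: card_unit_fibre)
qed

text \<open>Generators of one cyclic module share their orbit, so orbit-stabilizer forces equal
  sizes; the stabilizers themselves are conjugate and may differ.\<close>

lemma card_unit_stabilizer_cong:
  fixes g h :: "'a::{ring_1,finite} vec"
  assumes "cyclic_right g = cyclic_right h"
  shows "card (unit_stabilizer g) = card (unit_stabilizer h)"
proof -
  have "unit_orbit g = unit_orbit h"
    using assms by (simp add: set_eq_iff flip: cyclic_right_eq_iff_unit_orbit)
  moreover have "card (unit_orbit g) \<noteq> 0"
    using ring_units_one by (auto simp: unit_orbit_def)
  ultimately show ?thesis
    using card_unit_orbit[of g] card_unit_orbit[of h] by (metis mult_cancel1)
qed

section \<open>Partial difference sets and character values\<close>

text \<open>The characters of a finite abelian group \<open>A\<close>, indexed by a set \<open>X\<close> that may list each of them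
  several times; \<open>Z\<close> is the set of indices of the trivial character.\<close>
locale character_pairing = comm_group A for A (structure) +
  fixes X Z :: "'x set" and \<beta> :: "'x \<Rightarrow> 'a \<Rightarrow> complex"
  assumes finite_carrier: "finite (carrier A)"
    and finite_X: "finite X" and Z_subset: "Z \<subseteq> X" and Z_nonempty: "Z \<noteq> {}"
    and pairing_mult: "\<And>x a b. x \<in> X \<Longrightarrow> a \<in> carrier A \<Longrightarrow> b \<in> carrier A \<Longrightarrow>
      \<beta> x (a \<otimes> b) = \<beta> x a * \<beta> x b"
    and pairing_one: "\<And>x. x \<in> X \<Longrightarrow> \<beta> x \<one> = 1"
    and pairing_Z: "\<And>x a. x \<in> Z \<Longrightarrow> a \<in> carrier A \<Longrightarrow> \<beta> x a = 1"
    and sum_pairing_carrier: "\<And>x. x \<in> X - Z \<Longrightarrow> (\<Sum>a\<in>carrier A. \<beta> x a) = 0"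
    and sum_pairing_X: "\<And>a. a \<in> carrier A \<Longrightarrow> a \<noteq> \<one> \<Longrightarrow> (\<Sum>x\<in>X. \<beta> x a) = 0"
begin

text \<open>The unnormalised Fourier transform on \<open>A\<close>, evaluated at indices in place of
  characters.\<close>

definition transform :: "('a \<Rightarrow> complex) \<Rightarrow> 'x \<Rightarrow> complex" where
  "transform h x = (\<Sum>a\<in>carrier A. h a * \<beta> x a)"

text \<open>Fourier inversion: pairing the transform with the character values at
  \<open>inv a\<close> and summing over \<open>X\<close> leaves \<open>h a\<close> times the size of
  \<open>X\<close>. Identities between functions on the group can thus be checked on the transform
  side.\<close>

lemma transform_eq_0D:
  assumes h: "\<And>x. x \<in> X \<Longrightarrow> transform h x = 0" and a: "a \<in> carrier A"
  shows "h a = 0"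
proof -
  have "0 = (\<Sum>x\<in>X. \<beta> x (inv a) * transform h x)"
    using h by simp
  also have "\<dots> = (\<Sum>x\<in>X. \<Sum>b\<in>carrier A. h b * \<beta> x (inv a \<otimes> b))"
    using a by (intro sum.cong refl)
      (simp add: transform_def sum_distrib_left pairing_mult mult.left_commute)
  also have "\<dots> = (\<Sum>b\<in>carrier A. h b * (\<Sum>x\<in>X. \<beta> x (inv a \<otimes> b)))"
    by (subst sum.swap) (simp add: sum_distrib_left)
  also have "\<dots> = (\<Sum>b\<in>carrier A. if b = a then h a * of_nat (card X) else 0)"
  proof (rule sum.cong)
    fix b assume b: "b \<in> carrier A"
    have "inv a \<otimes> b = \<one> \<longleftrightarrow> b = a"
      using a b by (metis inv_closed inv_inv inv_equality l_inv m_comm)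
    then show "h b * (\<Sum>x\<in>X. \<beta> x (inv a \<otimes> b)) = (if b = a then h a * of_nat (card X) else 0)"
      using a b sum_pairing_X[of "inv a \<otimes> b"] by (auto simp: pairing_one)
  qed simp
  also have "\<dots> = h a * of_nat (card X)"
    using a finite_carrier by simp
  finally show ?thesis
    using finite_X Z_subset Z_nonempty by auto
qed

section \<open>Transforms of elementary functions and of difference counts\<close>

lemma transform_add: "transform (\<lambda>a. g a + h a) x = transform g x + transform h x"
  by (simp add: transform_def distrib_right sum.distrib)

lemma transform_diff: "transform (\<lambda>a. g a - h a) x = transform g x - transform h x"
  by (simp add: transform_def left_diff_distrib sum_subtractf)

lemma transform_scale: "transform (\<lambda>a. c * h a) x = c * transform h x"
  by (simp add: transform_def sum_distrib_left mult.assoc)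

lemma transform_const:
  "x \<in> X \<Longrightarrow> transform (\<lambda>a. c) x = (if x \<in> Z then c * of_nat (card (carrier A)) else 0)"
  by (simp add: transform_def sum_pairing_carrier pairing_Z flip: sum_distrib_left)

lemma transform_indicator:
  "E \<subseteq> carrier A \<Longrightarrow> transform (\<lambda>a. of_bool (a \<in> E)) x = (\<Sum>e\<in>E. \<beta> x e)"
  using finite_carrier
  by (simp add: transform_def of_bool_def if_distrib[of "\<lambda>c. c * _"] Int_absorb1 flip: sum.inter_restrict cong: if_cong)

lemma transform_one: "x \<in> X \<Longrightarrow> transform (\<lambda>a. of_bool (a = \<one>)) x = 1"
  using transform_indicator[of "{\<one>}" x] by (simp add: pairing_one)

definition differences :: "'a set \<Rightarrow> 'a \<Rightarrow> nat" where
  "differences E d = card {(x, y). x \<in> E \<and> y \<in> E \<and> x \<otimes> inv y = d}"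

text \<open>The difference count is the convolution of the indicators of \<open>E\<close> and of its
  set of inverses. The transform turns this into a product, and closure under inverses makes the two
  factors equal.\<close>

lemma transform_differences:
  assumes E: "E \<subseteq> carrier A" "m_inv A ` E = E" and x: "x \<in> X"
  shows "transform (\<lambda>d. of_nat (differences E d)) x = (\<Sum>e\<in>E. \<beta> x e)\<^sup>2"
proof -
  have fin: "finite (E \<times> E)"
    using finite_subset[OF E(1) finite_carrier] by simp
  have inj: "inj_on (m_inv A) E"
    by (rule inj_on_inverseI[of _ "m_inv A"]) (use E(1) in auto)
  define q where "q = (\<lambda>(a, b). a \<otimes> inv b)"
  have q: "q ` (E \<times> E) \<subseteq> carrier A"
    using E(1) by (auto simp: q_def)
  have "transform (\<lambda>d. of_nat (differences E d)) x =
      (\<Sum>d\<in>carrier A. \<Sum>p\<in>{p \<in> E \<times> E. q p = d}. \<beta> x (q p))"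
    unfolding transform_def
  proof (rule sum.cong)
    fix d
    have "{(x, y). x \<in> E \<and> y \<in> E \<and> x \<otimes> inv y = d} = {p \<in> E \<times> E. q p = d}"
      by (auto simp: q_def)
    then show "of_nat (differences E d) * \<beta> x d = (\<Sum>p\<in>{p \<in> E \<times> E. q p = d}. \<beta> x (q p))"
      by (simp add: differences_def)
  qed simp
  also have "\<dots> = (\<Sum>p\<in>E \<times> E. \<beta> x (q p))"
    by (rule sum.group[OF fin finite_carrier q])
  also have "\<dots> = (\<Sum>a\<in>E. \<Sum>b\<in>E. \<beta> x a * \<beta> x (inv b))"
    unfolding sum.cartesian_product[symmetric]
    using E(1) x by (auto simp: q_def sum.cartesian_product pairing_mult subset_iff intro!: sum.cong)
  also have "\<dots> = (\<Sum>a\<in>E. \<beta> x a) * (\<Sum>b\<in>E. \<beta> x (inv b))"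
    by (simp add: sum_product)
  also have "(\<Sum>b\<in>E. \<beta> x (inv b)) = (\<Sum>b\<in>m_inv A ` E. \<beta> x b)"
    using sum.reindex[OF inj, of "\<beta> x"] by simp
  finally show ?thesis
    using E(2) by (simp add: power2_eq_square)
qed


section \<open>Partial difference sets and quadratic equations for character values\<close>

lemma two_values_imp_regular_pds:
  assumes E: "E \<subseteq> carrier A" "\<one> \<notin> E" "m_inv A ` E = E"
    and two: "\<And>x. x \<in> X - Z \<Longrightarrow> (\<Sum>e\<in>E. \<beta> x e) \<in> {a, b}"
  shows "regular_pds A E"
proof -
  define f where "f x = (\<Sum>e\<in>E. \<beta> x e)" for x
  define K :: complex where "K = of_nat (card E)"
  define N :: complex where "N = of_nat (card (carrier A))"
  \<comment> \<open>Off \<open>Z\<close> the transform of \<open>h\<close> below is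
    \<open>(f x - a) * (f x - b) = 0\<close>. On \<open>Z\<close> the character sum is
    \<open>K\<close>, and \<open>q\<close> is chosen so that the constant function cancels
    \<open>(K - a) * (K - b)\<close>.\<close>
  define q where "q = (K - a) * (K - b) / N"
  define h :: "'a \<Rightarrow> complex" where
    "h d = of_nat (differences E d) - (a + b) * of_bool (d \<in> E) + a * b * of_bool (d = \<one>) - q" for d
  have "card (carrier A) \<noteq> 0"
    using finite_carrier by auto
  then have qN: "q * N = (K - a) * (K - b)"
    by (simp add: q_def N_def)
  have "transform h x = 0" if x: "x \<in> X" for x
  proof -
    have t: "transform h x = (f x)\<^sup>2 - (a + b) * f x + a * b - (if x \<in> Z then q * N else 0)"
      using x E unfolding h_def f_def N_def
      by (simp add: transform_add transform_diff transform_scale transform_differences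
          transform_indicator transform_one transform_const)
    show ?thesis
    proof (cases "x \<in> Z")
      case True
      then have "f x = K"
        using E(1) by (simp add: f_def K_def pairing_Z subset_iff)
      then show ?thesis
        using True unfolding t qN by (simp add: algebra_simps power2_eq_square)
    next
      case False
      then have "(f x - a) * (f x - b) = 0"
        using two[of x] x by (auto simp: f_def)
      then show ?thesis
        using False by (simp add: t algebra_simps power2_eq_square)
    qed
  qed
  then have h: "h d = 0" if "d \<in> carrier A" for d
    using that by (rule transform_eq_0D)
  \<comment> \<open>Vanishing of \<open>h\<close> reads off both parameters: the count is
    \<open>a + b + q\<close> on \<open>E\<close>, and \<open>q\<close> outside \<open>E\<close> and
    the identity.\<close>
  have "\<exists>l. \<forall>d\<in>E. differences E d = l"
  proof -
    have "of_nat (differences E d) = a + b + q" if "d \<in> E" for d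
      using h[of d] that E(1,2) by (cases "d = \<one>") (auto simp: h_def algebra_simps)
    then have "differences E d = differences E d'" if "d \<in> E" "d' \<in> E" for d d'
      using that by (metis of_nat_eq_iff)
    then show ?thesis by blast
  qed
  moreover have "\<exists>m. \<forall>d\<in>carrier A - (E \<union> {\<one>}). differences E d = m"
  proof -
    have "of_nat (differences E d) = q" if "d \<in> carrier A - (E \<union> {\<one>})" for d
      using h[of d] that by (auto simp: h_def)
    then have "differences E d = differences E d'"
      if "d \<in> carrier A - (E \<union> {\<one>})" "d' \<in> carrier A - (E \<union> {\<one>})" for d d'
      using that by (metis of_nat_eq_iff)
    then show ?thesis by blast
  qed
  ultimately show ?thesis
    using E finite_carrier comm_group_axioms
    unfolding regular_pds_def regular_pds_with_def differences_def by blast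
qed

text \<open>A regular partial difference set has a difference count that is a combination of the
  indicator of \<open>E\<close>, the point mass at the identity and a constant. Transforming this
  gives the equation, since the constant vanishes off \<open>Z\<close>.\<close>

lemma regular_pds_imp_quadratic:
  assumes E: "E \<subseteq> carrier A" and pds: "regular_pds A E"
  shows "\<exists>s p. \<forall>x\<in>X - Z. (\<Sum>e\<in>E. \<beta> x e)\<^sup>2 = s * (\<Sum>e\<in>E. \<beta> x e) + p"
proof -
  obtain l m where one: "\<one> \<notin> E" and inv: "m_inv A ` E = E"
    and l: "\<And>d. d \<in> E \<Longrightarrow> differences E d = l"
    and m: "\<And>d. d \<in> carrier A - (E \<union> {\<one>}) \<Longrightarrow> differences E d = m"
    using pds unfolding regular_pds_def regular_pds_with_def differences_def by blast
  define s :: complex where "s = of_nat l - of_nat m"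
  \<comment> \<open>The parameters \<open>l\<close> and \<open>m\<close> do not describe the count
    at the identity; \<open>p\<close> corrects for it there.\<close>
  define p :: complex where "p = of_nat (differences E \<one>) - of_nat m"
  have eq: "of_nat (differences E d) = s * of_bool (d \<in> E) + p * of_bool (d = \<one>) + of_nat m"
    if "d \<in> carrier A" for d
    using that l[of d] m[of d] one by (auto simp: s_def p_def)
  have "(\<Sum>e\<in>E. \<beta> x e)\<^sup>2 = s * (\<Sum>e\<in>E. \<beta> x e) + p" if x: "x \<in> X - Z" for x
  proof -
    have "(\<Sum>e\<in>E. \<beta> x e)\<^sup>2 = transform (\<lambda>d. of_nat (differences E d)) x"
      using E inv x by (simp add: transform_differences)
    also have "\<dots> = transform (\<lambda>d. s * of_bool (d \<in> E) + p * of_bool (d = \<one>) + of_nat m) x"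
      using eq by (auto simp: transform_def intro!: sum.cong)
    also have "\<dots> = s * (\<Sum>e\<in>E. \<beta> x e) + p"
      using E x by (simp add: transform_add transform_scale transform_indicator transform_one
          transform_const)
    finally show ?thesis .
  qed
  then show ?thesis by blast
qed

text \<open>By inversion, the indicator of \<open>E\<close> is \<open>a\<close> times the point mass
  at the identity plus a constant \<open>q\<close>. So it is constant off the identity, and an
  element of \<open>E\<close> shows that this constant is 1.\<close>

lemma constant_imp_all_nonidentity:
  assumes E: "E \<subseteq> carrier A" "E \<noteq> {}" "\<one> \<notin> E"
    and const: "\<And>x. x \<in> X - Z \<Longrightarrow> (\<Sum>e\<in>E. \<beta> x e) = a"
  shows "E \<union> {\<one>} = carrier A"
proof -
  define N :: complex where "N = of_nat (card (carrier A))"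
  define q where "q = (of_nat (card E) - a) / N"
  define h :: "'a \<Rightarrow> complex" where "h d = of_bool (d \<in> E) - a * of_bool (d = \<one>) - q" for d
  have "card (carrier A) \<noteq> 0"
    using finite_carrier by auto
  then have qN: "q * N = of_nat (card E) - a"
    by (simp add: q_def N_def)
  have "transform h x = 0" if x: "x \<in> X" for x
  proof -
    have "transform h x = (\<Sum>e\<in>E. \<beta> x e) - a - (if x \<in> Z then q * N else 0)"
      using x E unfolding h_def N_def
      by (simp add: transform_diff transform_scale transform_indicator transform_one transform_const)
    moreover have "(\<Sum>e\<in>E. \<beta> x e) = of_nat (card E)" if "x \<in> Z"
      using that E(1) by (simp add: pairing_Z subset_iff)
    ultimately show ?thesis
      using x const by (auto simp: qN)
  qed
  then have h: "h d = 0" if "d \<in> carrier A" for d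
    using that by (rule transform_eq_0D)
  obtain e where e: "e \<in> E"
    using E(2) by blast
  then have "q = 1"
    using h[of e] E(1,3) by (auto simp: h_def of_bool_def split: if_splits)
  then have "d \<in> E" if "d \<in> carrier A" "d \<noteq> \<one>" for d
    using h[of d] that by (auto simp: h_def split: if_splits)
  then show ?thesis
    using E(1) by auto
qed

theorem two_character_values_iff_regular_pds:
  assumes E: "E \<subseteq> carrier A" "E \<noteq> {}" "\<one> \<notin> E" "m_inv A ` E = E"
  shows "card ((\<lambda>x. \<Sum>e\<in>E. \<beta> x e) ` (X - Z)) = 2 \<longleftrightarrow>
    regular_pds A E \<and> E \<union> {\<one>} \<noteq> carrier A"
proof -
  define V where "V = (\<lambda>x. \<Sum>e\<in>E. \<beta> x e) ` (X - Z)"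
  have V: "(\<Sum>e\<in>E. \<beta> x e) \<in> V" if "x \<in> X - Z" for x
    using that by (auto simp: V_def)
  have "regular_pds A E \<and> E \<union> {\<one>} \<noteq> carrier A" if card: "card V = 2"
  proof
    obtain a b where ab: "V = {a, b}" "a \<noteq> b"
      using card by (auto simp: card_2_iff)
    then show "regular_pds A E"
      using V E by (intro two_values_imp_regular_pds[where a = a and b = b]) auto
    show "E \<union> {\<one>} \<noteq> carrier A"
    proof
      assume "E \<union> {\<one>} = carrier A"
      \<comment> \<open>Orthogonality forces every nontrivial character sum over the nonidentity
        elements to be -1, so two distinct values are impossible.\<close>
      then have sum: "(\<Sum>e\<in>carrier A. \<beta> x e) = \<beta> x \<one> + (\<Sum>e\<in>E. \<beta> x e)" for x
        using E(3) finite_carrier by (metis Un_insert_right finite_Un sum.insert sup_bot_right)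
      have "(\<Sum>e\<in>E. \<beta> x e) = - 1" if "x \<in> X - Z" for x
        using sum[of x] that sum_pairing_carrier[OF that] pairing_one[of x]
        by (auto simp: add_eq_0_iff)
      then have "V \<subseteq> {- 1}" by (auto simp: V_def)
      then have "card V \<le> card {- 1 :: complex}" by (intro card_mono) auto
      then show False using card by simp
    qed
  qed
  moreover have "card V = 2" if pds: "regular_pds A E" and neq: "E \<union> {\<one>} \<noteq> carrier A"
  proof -
    obtain s p where quad: "\<And>x. x \<in> X - Z \<Longrightarrow> (\<Sum>e\<in>E. \<beta> x e)\<^sup>2 = s * (\<Sum>e\<in>E. \<beta> x e) + p"
      using regular_pds_imp_quadratic[OF E(1) pds] by blast
    \<comment> \<open>Inclusion in place of equality also rules out that \<open>V\<close> is
      empty.\<close>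
    have not_const: "\<not> V \<subseteq> {a}" for a
      using constant_imp_all_nonidentity[OF E(1-3), of a] neq V by blast
    then obtain a where a: "a \<in> V" by blast
    then obtain b where b: "b \<in> V" "b \<noteq> a"
      using not_const[of a] by blast
    have sq: "v\<^sup>2 = s * v + p" if "v \<in> V" for v
      using that quad by (auto simp: V_def)
    \<comment> \<open>All values are roots of one monic quadratic with root sum \<open>s\<close>, so
      \<open>s - a\<close> is the only candidate besides \<open>a\<close>.\<close>
    have "v = a \<or> v = s - a" if "v \<in> V" for v
    proof -
      have "(v - a) * (v - (s - a)) = v\<^sup>2 - s * v - (a\<^sup>2 - s * a)"
        by (simp add: algebra_simps power2_eq_square)
      also have "\<dots> = 0"
        using sq[OF that] sq[OF a] by simp
      finally show ?thesis by simp
    qed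
    then have "V = {a, b}"
      using a b by blast
    then show ?thesis
      using b(2) by simp
  qed
  ultimately show ?thesis
    unfolding V_def by blast
qed

end

section \<open>Column spaces\<close>

lemma finite_carrier_vec: "finite (carrier_vec k :: 'a::finite vec set)"
proof -
  have "carrier_vec k \<subseteq> vec_of_list ` {xs :: 'a list. set xs \<subseteq> UNIV \<and> length xs = k}"
  proof
    fix v :: "'a vec" assume "v \<in> carrier_vec k"
    then show "v \<in> vec_of_list ` {xs. set xs \<subseteq> UNIV \<and> length xs = k}"
      by (intro image_eqI[where x = "list_of_vec v"]) (auto simp: vec_list)
  qed
  moreover have "finite {xs :: 'a list. set xs \<subseteq> UNIV \<and> length xs = k}"
    by (rule finite_lists_length_eq) simp
  ultimately show ?thesis
    by (meson finite_imageI finite_subset)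
qed

lemma smult_vec_right_uminus_one:
  "v \<in> carrier_vec k \<Longrightarrow> smult_vec_right v (- 1 :: 'a::ring_1) = - v"
  by (rule eq_vecI) auto

lemma right_submodule_right_col_space:
  assumes G: "G \<in> carrier_mat k n"
  shows "right_submodule k (right_col_space G)"
  unfolding right_submodule_def
proof (intro conjI ballI allI)
  show "right_col_space G \<subseteq> carrier_vec k"
    using G by (auto simp: right_col_space_def)
  have "0\<^sub>v k = G *\<^sub>v 0\<^sub>v n"
    using G by (intro eq_vecI) auto
  then show "0\<^sub>v k \<in> right_col_space G"
    using G unfolding right_col_space_def by auto
next
  fix a b assume "a \<in> right_col_space G" "b \<in> right_col_space G"
  then obtain y z where yz: "y \<in> carrier_vec n" "z \<in> carrier_vec n" "a = G *\<^sub>v y" "b = G *\<^sub>v z"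
    using G unfolding right_col_space_def by auto
  then have "a + b = G *\<^sub>v (y + z)"
    using G by (simp add: mult_add_distrib_mat_vec)
  moreover have "y + z \<in> carrier_vec n"
    using yz by simp
  ultimately show "a + b \<in> right_col_space G"
    using G unfolding right_col_space_def by auto
next
  fix a b assume "b \<in> right_col_space G"
  then obtain y where y: "y \<in> carrier_vec n" "b = G *\<^sub>v y"
    using G unfolding right_col_space_def by auto
  then have "smult_vec_right b a = G *\<^sub>v smult_vec_right y a"
    using G by (intro eq_vecI) (auto simp: scalar_prod_smult_vec_right)
  moreover have "smult_vec_right y a \<in> carrier_vec n"
    using y by simp
  ultimately show "smult_vec_right b a \<in> right_col_space G"
    using G unfolding right_col_space_def by auto
qed

lemma col_in_right_col_space:
  assumes G: "G \<in> carrier_mat k n" and j: "j < n"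
  shows "col G j \<in> right_col_space G"
proof -
  have "col G j = G *\<^sub>v unit_vec n j"
    using G j by (intro eq_vecI) auto
  then show ?thesis
    using G unfolding right_col_space_def by auto
qed

text \<open>\<open>G y\<close> is the combination of the columns with right coefficients
  \<open>y\<close>, built up one column at a time. This minimality of the column space serves for
  kernels of rows and for the submodule condition on \<Omega>.\<close>

lemma right_col_space_subset:
  assumes G: "G \<in> carrier_mat k n" and S: "right_submodule k S"
    and cols: "\<And>j. j < n \<Longrightarrow> col G j \<in> S"
  shows "right_col_space G \<subseteq> S"
proof
  fix d assume "d \<in> right_col_space G"
  then obtain y where y: "y \<in> carrier_vec n" and d: "d = G *\<^sub>v y"
    using G unfolding right_col_space_def by auto
  have "m \<le> n \<Longrightarrow> vec k (\<lambda>i. \<Sum>j<m. G $$ (i, j) * y $ j) \<in> S" for m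
  proof (induction m)
    case 0
    have "vec k (\<lambda>i. \<Sum>j<0. G $$ (i, j) * y $ j) = 0\<^sub>v k"
      by (rule eq_vecI) auto
    then show ?case
      using S by (simp add: right_submodule_def)
  next
    case (Suc m)
    have "vec k (\<lambda>i. \<Sum>j<Suc m. G $$ (i, j) * y $ j) =
        vec k (\<lambda>i. \<Sum>j<m. G $$ (i, j) * y $ j) + smult_vec_right (col G m) (y $ m)"
      using G Suc.prems by (intro eq_vecI) auto
    then show ?case
      using S Suc cols[of m] by (simp add: right_submodule_def)
  qed
  moreover have "d = vec k (\<lambda>i. \<Sum>j<n. G $$ (i, j) * y $ j)"
    unfolding d using G y by (intro eq_vecI) (auto simp: scalar_prod_def atLeast0LessThan)
  ultimately show "d \<in> S" by simp
qed

lemma right_submodule_kernel: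
  assumes "x \<in> carrier_vec k"
  shows "right_submodule k {d \<in> carrier_vec k. x \<bullet> d = 0}"
  unfolding right_submodule_def
  using assms by (auto simp: scalar_prod_add_distrib scalar_prod_smult_vec_right)

section \<open>Submodules as abelian groups and their characters\<close>

lemma carrier_vec_subgroup [simp]: "carrier (vec_subgroup k D) = D"
  and mult_vec_subgroup [simp]: "x \<otimes>\<^bsub>vec_subgroup k D\<^esub> y = x + y"
  and one_vec_subgroup [simp]: "\<one>\<^bsub>vec_subgroup k D\<^esub> = 0\<^sub>v k"
  by (simp_all add: vec_subgroup_def monoid_vec_def)

lemma comm_group_vec_subgroup:
  assumes D: "right_submodule k D"
  shows "comm_group (vec_subgroup k D)"
    and "d \<in> D \<Longrightarrow> inv\<^bsub>vec_subgroup k D\<^esub> d = - d"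
proof -
  have sub: "D \<subseteq> carrier_vec k" and zero: "0\<^sub>v k \<in> D"
    and add: "\<And>x y. x \<in> D \<Longrightarrow> y \<in> D \<Longrightarrow> x + y \<in> D"
    and smult: "\<And>x a. x \<in> D \<Longrightarrow> smult_vec_right x a \<in> D"
    using D unfolding right_submodule_def by blast+
  have uminus: "- x \<in> D" if "x \<in> D" for x
    using smult[OF that, of "- 1"] sub that smult_vec_right_uminus_one[of x k] by auto
  show cg: "comm_group (vec_subgroup k D)"
  proof (rule comm_groupI, unfold carrier_vec_subgroup mult_vec_subgroup one_vec_subgroup)
    fix x assume x: "x \<in> D"
    then have "x \<in> carrier_vec k" using sub by blast
    then have "- x + x = 0\<^sub>v k" by simp
    then show "\<exists>y\<in>D. y + x = 0\<^sub>v k" using uminus[OF x] by blast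
    show "0\<^sub>v k + x = x" using \<open>x \<in> carrier_vec k\<close> by simp
  next
    fix x y z assume "x \<in> D" "y \<in> D" "z \<in> D"
    then show "x + y + z = x + (y + z)"
      using sub by (intro assoc_add_vec[of _ k]) auto
  next
    fix x y assume "x \<in> D" "y \<in> D"
    then show "x + y = y + x"
      using sub by (intro comm_add_vec[of _ k]) auto
  qed (use zero add in auto)
  assume d: "d \<in> D"
  then have "d \<in> carrier_vec k" using sub by blast
  then have "- d + d = 0\<^sub>v k" by simp
  then show "inv\<^bsub>vec_subgroup k D\<^esub> d = - d"
    using d uminus[OF d] comm_group.axioms(2)[OF cg]
    by (intro group.inv_equality) auto
qed

lemma character_pairing_right_col_space:
  fixes \<chi> :: "'a::{ring_1,finite} \<Rightarrow> complex"
  assumes gen: "generating_character \<chi>" and G: "G \<in> carrier_mat k n"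
  shows "character_pairing (vec_subgroup k (right_col_space G)) (carrier_vec k)
    {x \<in> carrier_vec k. row_mult_mat x G = 0\<^sub>v n} (\<lambda>x d. \<chi> (x \<bullet> d))"
proof -
  let ?D = "right_col_space G"
  let ?Z = "{x \<in> carrier_vec k. row_mult_mat x G = 0\<^sub>v n}"
  have ac: "additive_character \<chi>"
    using gen unfolding generating_character_def by blast
  have D: "right_submodule k ?D"
    by (rule right_submodule_right_col_space[OF G])
  then have sub: "?D \<subseteq> carrier_vec k"
    unfolding right_submodule_def by blast
  have add: "\<chi> (x \<bullet> (d + e)) = \<chi> (x \<bullet> d) * \<chi> (x \<bullet> e)"
    if "x \<in> carrier_vec k" "d \<in> ?D" "e \<in> ?D" for x d e
  proof -
    have "x \<bullet> (d + e) = x \<bullet> d + x \<bullet> e"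
      using that sub by (intro scalar_prod_add_distrib[of _ k]) auto
    then show ?thesis by (simp add: additive_character_add[OF ac])
  qed
  have trivial: "\<chi> (x \<bullet> d) = 1" if x: "x \<in> ?Z" and d: "d \<in> ?D" for x d
  proof -
    have "?D \<subseteq> {d \<in> carrier_vec k. x \<bullet> d = 0}"
    proof (rule right_col_space_subset[OF G right_submodule_kernel])
      fix j assume j: "j < n"
      then have "row_mult_mat x G $ j = x \<bullet> col G j"
        using G by (simp add: row_mult_mat_def)
      then show "col G j \<in> {d \<in> carrier_vec k. x \<bullet> d = 0}"
        using G x j by simp
    qed (use x in simp)
    then show ?thesis
      using d additive_character_zero[OF ac] by auto
  qed
  have sum_D: "(\<Sum>d\<in>?D. \<chi> (x \<bullet> d)) = 0" if x: "x \<in> carrier_vec k - ?Z" for x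
  proof -
    have "row_mult_mat x G \<noteq> 0\<^sub>v n" using x by blast
    \<comment> \<open>Right nondegeneracy is the relevant side: the multiplier \<open>a\<close>
      moves into the column, and the column space is closed under right multiples. Translation by
      the resulting \<open>y\<close> makes the sum vanish.\<close>
    then obtain j where j: "j < n" "x \<bullet> col G j \<noteq> 0"
      using G unfolding row_mult_mat_def by (auto simp: vec_eq_iff)
    then obtain a where a: "\<chi> ((x \<bullet> col G j) * a) \<noteq> 1"
      using generating_character_nondegenerate(2)[OF gen] by blast
    define y where "y = smult_vec_right (col G j) a"
    have yD: "y \<in> ?D"
      using D col_in_right_col_space[OF G j(1)] unfolding y_def right_submodule_def by blast
    have y1: "\<chi> (x \<bullet> y) \<noteq> 1"
      using a x G by (simp add: y_def scalar_prod_smult_vec_right)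
    have "bij_betw (\<lambda>d. y + d) ?D ?D"
    proof (rule bij_betw_byWitness[where f' = "\<lambda>d. - y + d"])
      have "- y \<in> ?D"
        using D yD sub smult_vec_right_uminus_one[of y k] unfolding right_submodule_def
        by (metis subsetD)
      then show "(\<lambda>d. y + d) ` ?D \<subseteq> ?D" "(\<lambda>d. - y + d) ` ?D \<subseteq> ?D"
        using D yD unfolding right_submodule_def by auto
      have "- y + (y + d) = d" "y + (- y + d) = d" if "d \<in> carrier_vec k" for d
        using that yD sub by (auto intro!: eq_vecI)
      then show "\<forall>d\<in>?D. - y + (y + d) = d" "\<forall>d\<in>?D. y + (- y + d) = d"
        using sub by auto
    qed
    then show ?thesis
      by (rule sum_eq_0_of_translation) (use add x yD y1 in auto)
  qed
  have sum_X: "(\<Sum>x\<in>carrier_vec k. \<chi> (x \<bullet> d)) = 0" if d: "d \<in> ?D" "d \<noteq> 0\<^sub>v k" for d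
  proof -
    have dk: "d \<in> carrier_vec k" using d sub by blast
    then obtain i where i: "i < k" "d $ i \<noteq> 0"
      using d(2) by (auto simp: vec_eq_iff)
    \<comment> \<open>Here left nondegeneracy is used, the multiplier being absorbed into the row
      vector \<open>y\<close> by which the sum over all rows is translated.\<close>
    then obtain a where a: "\<chi> (a * d $ i) \<noteq> 1"
      using generating_character_nondegenerate(1)[OF gen] by blast
    define y where "y = a \<cdot>\<^sub>v unit_vec k i"
    have yk: "y \<in> carrier_vec k" by (simp add: y_def)
    have y1: "\<chi> (y \<bullet> d) \<noteq> 1"
      using a dk i smult_scalar_prod_distrib[OF unit_vec_carrier dk, of a i] by (simp add: y_def)
    have "bij_betw (\<lambda>x. y + x) (carrier_vec k) (carrier_vec k)"
      by (rule bij_betw_byWitness[where f' = "\<lambda>x. - y + x"]) (use yk in \<open>auto intro!: eq_vecI\<close>)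
    moreover have "\<chi> ((y + x) \<bullet> d) = \<chi> (y \<bullet> d) * \<chi> (x \<bullet> d)" if "x \<in> carrier_vec k" for x
      using add_scalar_prod_distrib[OF yk that dk] by (simp add: additive_character_add[OF ac])
    ultimately show ?thesis
      using y1 by (rule sum_eq_0_of_translation)
  qed
  have "0\<^sub>v k \<in> ?Z"
    using G by (auto simp: row_mult_mat_def intro!: eq_vecI)
  then have Z: "?Z \<noteq> {}" by blast
  have zero: "\<chi> (x \<bullet> 0\<^sub>v k) = 1" if "x \<in> carrier_vec k" for x
    using that additive_character_zero[OF ac] by simp
  show ?thesis
    by (intro character_pairing.intro character_pairing_axioms.intro comm_group_vec_subgroup(1)[OF D],
        unfold carrier_vec_subgroup mult_vec_subgroup one_vec_subgroup)
      (use add trivial sum_D sum_X Z zero finite_carrier_vec finite_subset[OF sub finite_carrier_vec]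
        in \<open>blast+\<close>)
qed

section \<open>Modular codes\<close>

text \<open>The rows of \<open>G\<close> are codewords, obtained from unit vectors, so a relation
  between right multiples of two columns can be tested on the code. Such relations therefore agree
  for any two matrices generating the same code.\<close>

lemma smult_vec_right_col_eq_iff:
  assumes G: "G \<in> carrier_mat k n" and ij: "i < n" "j < n"
  shows "smult_vec_right (col G i) a = smult_vec_right (col G j) b \<longleftrightarrow>
    (\<forall>c\<in>row_code G. c $ i * a = c $ j * b)"
proof
  assume eq: "smult_vec_right (col G i) a = smult_vec_right (col G j) b"
  have "(x \<bullet> col G i) * a = (x \<bullet> col G j) * b" if "x \<in> carrier_vec k" for x
  proof -
    have "(x \<bullet> col G i) * a = x \<bullet> smult_vec_right (col G i) a"
      using that G by (simp add: scalar_prod_smult_vec_right)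
    also have "\<dots> = (x \<bullet> col G j) * b"
      unfolding eq using that G by (simp add: scalar_prod_smult_vec_right)
    finally show ?thesis .
  qed
  then show "\<forall>c\<in>row_code G. c $ i * a = c $ j * b"
    using G ij by (auto simp: row_code_def row_mult_mat_def)
next
  assume c: "\<forall>c\<in>row_code G. c $ i * a = c $ j * b"
  show "smult_vec_right (col G i) a = smult_vec_right (col G j) b"
  proof (rule eq_vecI)
    fix l assume "l < dim_vec (smult_vec_right (col G j) b)"
    then have l: "l < k" using G by simp
    have "row_mult_mat (unit_vec k l) G \<in> row_code G"
      using G unfolding row_code_def by auto
    then have "row_mult_mat (unit_vec k l) G $ i * a = row_mult_mat (unit_vec k l) G $ j * b"
      using c by blast
    moreover have "row_mult_mat (unit_vec k l) G $ i = col G i $ l" if "i < n" for i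
      using that G l scalar_prod_left_unit[of "col G i" k l] by (simp add: row_mult_mat_def)
    ultimately show "smult_vec_right (col G i) a $ l = smult_vec_right (col G j) b $ l"
      using G ij l by simp
  qed (use G in simp)
qed

text \<open>Writing the vectors as multiples by 1 puts equality of points into the form of the
  preceding relations between columns; the next lemma does the same for stabilizers.\<close>

lemma cyclic_right_eq_iff:
  fixes g h :: "'a::ring_1 vec"
  shows "cyclic_right g = cyclic_right h \<longleftrightarrow>
    (\<exists>a. smult_vec_right g a = smult_vec_right h 1) \<and> (\<exists>b. smult_vec_right h b = smult_vec_right g 1)"
  using cyclic_right_eqI cyclic_right_eqD by (metis smult_vec_right_one)

lemma unit_stabilizer_eq:
  "unit_stabilizer g = {u \<in> ring_units. smult_vec_right g u = smult_vec_right g 1}"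
  by (simp add: unit_stabilizer_def)

lemma point_mult_col:
  assumes "j < dim_col G"
  shows "point_mult G (cyclic_right (col G j)) \<noteq> 0"
proof -
  have "j \<in> {i. i < dim_col G \<and> cyclic_right (col G i) = cyclic_right (col G j)}"
    using assms by simp
  moreover have "finite {i. i < dim_col G \<and> cyclic_right (col G i) = cyclic_right (col G j)}"
    by (rule finite_subset[of _ "{..<dim_col G}"]) auto
  ultimately show ?thesis
    unfolding point_mult_def by (metis card_0_eq empty_iff)
qed

text \<open>The quantity on the left of the conclusion is determined by \<open>C\<close> alone, so it is the same
  for the matrix witnessing modularity and for \<open>G\<close>.\<close>
lemma modular_code_index:
  fixes G :: "'a::{ring_1,finite} mat"
  assumes G: "G \<in> carrier_mat k n" and C: "C = row_code G" and mod: "modular_code n C"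
    and nz: "no_zero_coordinate n C"
  shows "\<exists>r :: complex. \<forall>j<n.
    of_nat (point_mult G (cyclic_right (col G j)) * card (unit_stabilizer (col G j))) =
      r * of_nat (card (ring_units :: 'a set))"
proof -
  obtain k' H r where H: "H \<in> carrier_mat k' n" and CH: "C = row_code H"
    and r: "\<And>g. g \<in> carrier_vec k' \<Longrightarrow> g \<noteq> 0\<^sub>v k' \<Longrightarrow>
      point_mult H (cyclic_right g) = 0 \<or>
      of_nat (point_mult H (cyclic_right g)) = (r :: rat) * of_nat (card (unit_orbit g))"
    using mod unfolding modular_code_def by blast
  have smult: "smult_vec_right (col G i) a = smult_vec_right (col G j) b \<longleftrightarrow>
      smult_vec_right (col H i) a = smult_vec_right (col H j) b" if "i < n" "j < n" for i j a b
    using that C CH smult_vec_right_col_eq_iff[OF G] smult_vec_right_col_eq_iff[OF H] by simp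
  have "of_nat (point_mult G (cyclic_right (col G j)) * card (unit_stabilizer (col G j))) =
      (of_rat r * of_nat (card (ring_units :: 'a set)) :: complex)" if j: "j < n" for j
  proof -
    have "cyclic_right (col G i) = cyclic_right (col G j) \<longleftrightarrow>
        cyclic_right (col H i) = cyclic_right (col H j)" if i: "i < n" for i
      unfolding cyclic_right_eq_iff smult[OF i j] smult[OF j i] ..
    then have "point_mult G (cyclic_right (col G j)) = point_mult H (cyclic_right (col H j))"
      unfolding point_mult_def using G H by (intro arg_cong[where f = card]) auto
    moreover have "unit_stabilizer (col G j) = unit_stabilizer (col H j)"
      unfolding unit_stabilizer_eq smult[OF j j] ..
    moreover have "of_nat (point_mult H (cyclic_right (col H j))) = r * of_nat (card (unit_orbit (col H j)))"
    proof -
      \<comment> \<open>A nonzero coordinate makes column \<open>j\<close> of \<open>H\<close>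
        nonzero, so it generates a point. As this point has positive multiplicity, modularity leaves
        only the alternative with the index.\<close>
      obtain c where "c \<in> row_code H" "c $ j \<noteq> 0"
        using nz j CH unfolding no_zero_coordinate_def by blast
      then obtain x where "x \<in> carrier_vec k'" "x \<bullet> col H j \<noteq> 0"
        using H j by (auto simp: row_code_def row_mult_mat_def)
      then have "col H j \<noteq> 0\<^sub>v k'" by auto
      moreover have "point_mult H (cyclic_right (col H j)) \<noteq> 0"
        using H j by (intro point_mult_col) simp
      moreover have "col H j \<in> carrier_vec k'" using H by (intro carrier_vecI) simp
      ultimately show ?thesis using r[of "col H j"] by simp
    qed
    then have "(of_rat (of_nat (point_mult H (cyclic_right (col H j)))) :: complex) =
        of_rat (r * of_nat (card (unit_orbit (col H j))))"
      by simp
    then have "(of_nat (point_mult H (cyclic_right (col H j))) :: complex) =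
        of_rat r * of_nat (card (unit_orbit (col H j)))"
      by (simp add: of_rat_mult)
    \<comment> \<open>Multiplying by the stabilizer size turns the orbit size into the number of
      units.\<close>
    ultimately show ?thesis
      by (simp flip: card_unit_orbit[of "col H j"])
  qed
  then show ?thesis by blast
qed

text \<open>Group the pairs \<open>(j, u)\<close> by the vector \<open>w\<close> they produce.
  Column \<open>j\<close> reaches \<open>w\<close> only if both generate the same point, and then
  through as many units as the stabilizer of \<open>w\<close> has. By the hypothesis on
  \<open>r\<close> the total is the same for every \<open>w\<close>.\<close>

lemma sum_columns_units:
  fixes G :: "'a::{ring_1,finite} mat" and F :: "'a vec \<Rightarrow> complex"
  assumes G: "G \<in> carrier_mat k n"
    and r: "\<And>j. j < n \<Longrightarrow>
      of_nat (point_mult G (cyclic_right (col G j)) * card (unit_stabilizer (col G j))) =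
        r * of_nat (card (ring_units :: 'a set))"
  shows "(\<Sum>j<n. \<Sum>u\<in>ring_units. F (smult_vec_right (col G j) u)) =
    r * of_nat (card (ring_units :: 'a set)) * (\<Sum>w\<in>(\<Union>j<n. unit_orbit (col G j)). F w)"
proof -
  define \<Omega> where "\<Omega> = (\<Union>j<n. unit_orbit (col G j))"
  define U where "U = (ring_units :: 'a set)"
  define h where "h = (\<lambda>(j, u). smult_vec_right (col G j) u)"
  have fin: "finite ({..<n} \<times> U)" "finite \<Omega>"
    by (auto simp: \<Omega>_def unit_orbit_def)
  have card: "of_nat (card {p \<in> {..<n} \<times> U. h p = w}) = r * of_nat (card U)" if w: "w \<in> \<Omega>" for w
  proof -
    obtain i where i: "i < n" "w \<in> unit_orbit (col G i)"
      using w unfolding \<Omega>_def by blast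
    then have ci: "cyclic_right (col G i) = cyclic_right w"
      by (simp add: cyclic_right_eq_iff_unit_orbit)
    have "{p \<in> {..<n} \<times> U. h p = w} = (SIGMA j:{..<n}. {u \<in> U. smult_vec_right (col G j) u = w})"
      by (auto simp: h_def)
    then have "card {p \<in> {..<n} \<times> U. h p = w} = (\<Sum>j<n. card {u \<in> U. smult_vec_right (col G j) u = w})"
      by (simp add: card_SigmaI)
    also have "\<dots> = (\<Sum>j<n. if cyclic_right (col G j) = cyclic_right w then card (unit_stabilizer w) else 0)"
    proof (rule sum.cong)
      fix j
      show "card {u \<in> U. smult_vec_right (col G j) u = w} =
        (if cyclic_right (col G j) = cyclic_right w then card (unit_stabilizer w) else 0)"
      proof (cases "cyclic_right (col G j) = cyclic_right w")
        case True
        then show ?thesis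
          using card_unit_fibre[of w "col G j"] card_unit_stabilizer_cong[OF True]
          by (simp add: U_def cyclic_right_eq_iff_unit_orbit)
      next
        case False
        then have "{u \<in> U. smult_vec_right (col G j) u = w} = {}"
          by (auto simp: U_def cyclic_right_eq_iff_unit_orbit unit_orbit_def)
        then show ?thesis using False by simp
      qed
    qed simp
    also have "\<dots> = point_mult G (cyclic_right w) * card (unit_stabilizer w)"
    proof -
      have "{..<n} \<inter> {j. cyclic_right (col G j) = cyclic_right w} =
          {j. j < dim_col G \<and> cyclic_right (col G j) = cyclic_right w}"
        using G by auto
      then show ?thesis by (simp add: sum.If_cases point_mult_def)
    qed
    finally show ?thesis
      using r[OF i(1)] card_unit_stabilizer_cong[OF ci] ci by (simp add: U_def)
  qed
  have "(\<Sum>j<n. \<Sum>u\<in>U. F (smult_vec_right (col G j) u)) = (\<Sum>p\<in>{..<n} \<times> U. F (h p))"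
    by (simp add: sum.cartesian_product h_def case_prod_unfold)
  also have "\<dots> = (\<Sum>w\<in>\<Omega>. \<Sum>p\<in>{p \<in> {..<n} \<times> U. h p = w}. F (h p))"
    by (rule sum.group[OF fin, symmetric]) (auto simp: \<Omega>_def unit_orbit_def h_def U_def)
  also have "\<dots> = (\<Sum>w\<in>\<Omega>. r * of_nat (card U) * F w)"
    by (intro sum.cong refl) (simp add: card)
  finally show ?thesis
    by (simp add: sum_distrib_left \<Omega>_def U_def)
qed

text \<open>Moving the unit from the left to the right of \<open>x \<bullet> col G j\<close> lets it
  act on the column; the sum over columns and units then collects over the union of the
  orbits.\<close>

lemma hom_weight_vec_row_mult_mat:
  fixes \<chi> :: "'a::{ring_1,finite} \<Rightarrow> complex"
  assumes gen: "generating_character \<chi>" and G: "G \<in> carrier_mat k n"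
    and r: "\<And>j. j < n \<Longrightarrow>
      of_nat (point_mult G (cyclic_right (col G j)) * card (unit_stabilizer (col G j))) =
        r * of_nat (card (ring_units :: 'a set))"
    and x: "x \<in> carrier_vec k"
  shows "hom_weight_vec \<chi> (row_mult_mat x G) =
    of_nat n - r * (\<Sum>w\<in>(\<Union>j<n. unit_orbit (col G j)). \<chi> (x \<bullet> w))"
proof -
  define q :: complex where "q = of_nat (card (ring_units :: 'a set))"
  have "card (ring_units :: 'a set) \<noteq> 0"
    using ring_units_one by auto
  then have q: "q \<noteq> 0" by (simp add: q_def)
  have "(\<Sum>u\<in>ring_units. \<chi> (u * (x \<bullet> col G j))) =
      (\<Sum>u\<in>ring_units. \<chi> (x \<bullet> smult_vec_right (col G j) u))" for j
    unfolding sum_ring_units_swap[OF gen] using x G by (simp add: scalar_prod_smult_vec_right)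
  then have "hom_weight_vec \<chi> (row_mult_mat x G) =
      (\<Sum>j<n. 1 - 1 / q * (\<Sum>u\<in>ring_units. \<chi> (x \<bullet> smult_vec_right (col G j) u)))"
    using G by (simp add: hom_weight_vec_def row_mult_mat_def hom_weight_def q_def)
  also have "\<dots> = of_nat n -
      1 / q * (\<Sum>j<n. \<Sum>u\<in>ring_units. \<chi> (x \<bullet> smult_vec_right (col G j) u))"
    by (simp add: sum_subtractf sum_distrib_left)
  also have "\<dots> = of_nat n - r * (\<Sum>w\<in>(\<Union>j<n. unit_orbit (col G j)). \<chi> (x \<bullet> w))"
    using q sum_columns_units[OF G r, of "\<lambda>w. \<chi> (x \<bullet> w)"] by (simp flip: q_def)
  finally show ?thesis .
qed

section \<open>From character values on the column space to weights of the code\<close>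

theorem theorem17:
  fixes \<chi> :: "'a::{ring_1,finite} \<Rightarrow> complex"
    and G :: "'a mat" and C D \<Omega> :: "'a vec set" and n k :: nat
  assumes "frobenius_ring TYPE('a)"
    and "generating_character \<chi>"
    and "G \<in> carrier_mat k n"
    and "left_submodule n C"
    and "C = row_code G"
    and "modular_code n C"
    and "no_zero_coordinate n C"
    and "zero_weight_words \<chi> C = {0\<^sub>v n}"
    and "D = right_col_space G"
    and "\<Omega> = (\<Union>j<n. unit_orbit (col G j))"
  shows "hom_two_weight_code \<chi> C \<longleftrightarrow>
    regular_pds (vec_subgroup k D) \<Omega> \<and> \<not> right_submodule k (\<Omega> \<union> {0\<^sub>v k})"
proof (cases "n = 0")
  case True
  \<comment> \<open>Without columns both sides fail: there is no nonzero weight, and \<Omega> is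
    empty, so adjoining 0 gives the zero submodule.\<close>
  have "hom_weight_vec \<chi> ` C \<subseteq> {0}"
    using assms(3,5) True
    by (auto simp: row_code_def row_mult_mat_def hom_weight_vec_def)
  then have "hom_weight_vec \<chi> ` C - {0} = {}" by blast
  then have "\<not> hom_two_weight_code \<chi> C"
    unfolding hom_two_weight_code_def by (simp only: card.empty)
  moreover have "smult_vec_right (0\<^sub>v k) a = 0\<^sub>v k" for a :: 'a
    by (rule eq_vecI) auto
  then have "right_submodule k (\<Omega> \<union> {0\<^sub>v k})"
    using assms(10) True by (simp add: right_submodule_def)
  ultimately show ?thesis by blast
next
  case False
  note gen = assms(2) and G = assms(3) and C = assms(5) and nz = assms(7)
    and zero = assms(8) and D = assms(9) and \<Omega> = assms(10)
  define Z where "Z = {x \<in> carrier_vec k. row_mult_mat x G = 0\<^sub>v n}"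
  interpret character_pairing "vec_subgroup k D" "carrier_vec k" Z "\<lambda>x d. \<chi> (x \<bullet> d)"
    unfolding D Z_def by (rule character_pairing_right_col_space[OF gen G])
  define f where "f x = (\<Sum>w\<in>\<Omega>. \<chi> (x \<bullet> w))" for x
  obtain r :: complex where r: "\<And>j. j < n \<Longrightarrow>
      of_nat (point_mult G (cyclic_right (col G j)) * card (unit_stabilizer (col G j))) =
        r * of_nat (card (ring_units :: 'a set))"
    using modular_code_index[OF G C assms(6) nz] by blast
  have subm: "right_submodule k D"
    unfolding D by (rule right_submodule_right_col_space[OF G])
  have col: "col G j \<in> \<Omega>" if "j < n" for j
    using that cyclic_right_eq_iff_unit_orbit[of "col G j" "col G j"] unfolding \<Omega> by blast
  have \<Omega>_D: "\<Omega> \<subseteq> D"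
    using subm col_in_right_col_space[OF G] unfolding \<Omega> D unit_orbit_def right_submodule_def
    by blast
  have col_nz: "col G j \<noteq> 0\<^sub>v k" if j: "j < n" for j
  proof -
    obtain c where "c \<in> row_code G" "c $ j \<noteq> 0"
      using nz j C unfolding no_zero_coordinate_def by blast
    then obtain x where "x \<in> carrier_vec k" "x \<bullet> col G j \<noteq> 0"
      using G j by (auto simp: row_code_def row_mult_mat_def)
    then show ?thesis by auto
  qed
  have zero_\<Omega>: "0\<^sub>v k \<notin> \<Omega>"
  proof
    assume "0\<^sub>v k \<in> \<Omega>"
    then obtain j where j: "j < n" "0\<^sub>v k \<in> unit_orbit (col G j)"
      unfolding \<Omega> by blast
    then obtain a where "col G j = smult_vec_right (0\<^sub>v k) a"
      using cyclic_right_eqD cyclic_right_eq_iff_unit_orbit by metis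
    also have "\<dots> = 0\<^sub>v k" by (rule eq_vecI) auto
    finally show False using col_nz[OF j(1)] by blast
  qed
  have uminus_\<Omega>: "- w \<in> \<Omega>" if w: "w \<in> \<Omega>" for w
  proof -
    obtain j u where j: "j < n" "u \<in> ring_units" "w = smult_vec_right (col G j) u"
      using w unfolding \<Omega> unit_orbit_def by blast
    have "- w = smult_vec_right (col G j) (- u)"
      using j by (intro eq_vecI) auto
    then show ?thesis
      using j ring_units_uminus unfolding \<Omega> unit_orbit_def by blast
  qed
  have inv_\<Omega>: "m_inv (vec_subgroup k D) ` \<Omega> = \<Omega>"
  proof -
    have "m_inv (vec_subgroup k D) ` \<Omega> = uminus ` \<Omega>"
      using \<Omega>_D comm_group_vec_subgroup(2)[OF subm] by (intro image_cong) auto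
    also have "\<dots> = \<Omega>"
    proof (intro equalityI subsetI)
      fix w assume "w \<in> \<Omega>"
      then show "w \<in> uminus ` \<Omega>"
        using uminus_\<Omega> by (intro image_eqI[of _ _ "- w"]) auto
    qed (use uminus_\<Omega> in auto)
    finally show ?thesis .
  qed
  have \<Omega>_nonempty: "\<Omega> \<noteq> {}"
    using col[of 0] False by blast
  \<comment> \<open>This makes the weight an injective affine function of \<open>f x\<close>, so
    that numbers of distinct values agree.\<close>
  have "r \<noteq> 0"
  proof
    assume "r = 0"
    then have "point_mult G (cyclic_right (col G 0)) * card (unit_stabilizer (col G 0)) = 0"
      using r[of 0] False by (simp flip: of_nat_mult)
    moreover have "1 \<in> unit_stabilizer (col G 0)"
      using ring_units_one by (simp add: unit_stabilizer_def)
    then have "card (unit_stabilizer (col G 0)) \<noteq> 0" by auto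
    moreover have "point_mult G (cyclic_right (col G 0)) \<noteq> 0"
      using G False by (intro point_mult_col) simp
    ultimately show False by simp
  qed
  have weight: "hom_weight_vec \<chi> (row_mult_mat x G) = of_nat n - r * f x"
    if "x \<in> carrier_vec k" for x
    unfolding f_def \<Omega> by (rule hom_weight_vec_row_mult_mat[OF gen G r that])
  have "hom_weight_vec \<chi> ` C - {0} = (\<lambda>t. of_nat n - r * t) ` f ` (carrier_vec k - Z)"
  proof -
    \<comment> \<open>As only the zero word has weight 0, the nonzero weights are those of the words
      \<open>x G\<close> with \<open>x\<close> outside \<open>Z\<close>, that is, with a nontrivial
      character.\<close>
    have "hom_weight_vec \<chi> c \<noteq> 0 \<longleftrightarrow> c \<noteq> 0\<^sub>v n" if "c \<in> C" for c
      using that zero unfolding zero_weight_words_def by blast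
    then have "{c \<in> C. hom_weight_vec \<chi> c \<noteq> 0} = C - {0\<^sub>v n}"
      by auto
    moreover have "hom_weight_vec \<chi> ` C - {0} = hom_weight_vec \<chi> ` {c \<in> C. hom_weight_vec \<chi> c \<noteq> 0}"
      by auto
    ultimately have "hom_weight_vec \<chi> ` C - {0} = hom_weight_vec \<chi> ` (C - {0\<^sub>v n})"
      by simp
    also have "C - {0\<^sub>v n} = (\<lambda>x. row_mult_mat x G) ` (carrier_vec k - Z)"
      using G unfolding C row_code_def Z_def by auto
    also have "hom_weight_vec \<chi> ` \<dots> = (\<lambda>x. of_nat n - r * f x) ` (carrier_vec k - Z)"
      unfolding image_image by (intro image_cong refl) (simp add: weight)
    finally show ?thesis
      by (simp only: image_image)
  qed
  moreover have "inj_on (\<lambda>t. of_nat n - r * t) A" for A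
    using \<open>r \<noteq> 0\<close> by (auto simp: inj_on_def)
  ultimately have "hom_two_weight_code \<chi> C \<longleftrightarrow> card (f ` (carrier_vec k - Z)) = 2"
    unfolding hom_two_weight_code_def by (simp add: card_image)
  also have "\<dots> \<longleftrightarrow> regular_pds (vec_subgroup k D) \<Omega> \<and> \<Omega> \<union> {0\<^sub>v k} \<noteq> D"
    using two_character_values_iff_regular_pds[of \<Omega>] \<Omega>_D \<Omega>_nonempty zero_\<Omega> inv_\<Omega>
    unfolding f_def by simp
  \<comment> \<open>A submodule containing \<Omega> contains all columns and hence
    \<open>D\<close>.\<close>
  also have "\<Omega> \<union> {0\<^sub>v k} = D \<longleftrightarrow> right_submodule k (\<Omega> \<union> {0\<^sub>v k})"
  proof
    assume sm: "right_submodule k (\<Omega> \<union> {0\<^sub>v k})"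
    have "D \<subseteq> \<Omega> \<union> {0\<^sub>v k}"
      unfolding D by (rule right_col_space_subset[OF G sm]) (use col in blast)
    moreover have "0\<^sub>v k \<in> D"
      using subm unfolding right_submodule_def by blast
    ultimately show "\<Omega> \<union> {0\<^sub>v k} = D"
      using \<Omega>_D by blast
  qed (use subm in simp)
  finally show ?thesis .
qed

end
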